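(* For an integer $d\geq 2$ and $\Phi\in[-1,1]$, let $\rho^{(d,\Phi)}$ be the Werner state on $\mathbb{C}^{d}\otimes\mathbb{C}^{d}$, $$\rho^{(d,\Phi)}=\frac{d-\Phi}{d^{3}-d}\,I_{\mathbb{C}^{d}\otimes\mathbb{C}^{d}}+\frac{d\Phi-1}{d^{3}-d}\,V_{d},$$ where $V_{d}$ is the flip operator, $V_{d}(\psi_{1}\otimes\psi_{2}):=\psi_{2}\otimes\psi_{1}$. (a) For every dimension $d\geq 3$, every Werner state $\rho^{(d,\Phi)}$, $\Phi\in[-1,1]$, separable or nonseparable, is a Bell class DSO state. (b) The two-qubit Werner state $\rho^{(2,\Phi)}$ is a Bell class DSO state whenever $\Phi\in[0,1]$ (that is, if $\rho^{(2,\Phi)}$ is separable).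
   Context: A quantum state on a Hilbert space is a density operator, i.e. a positive trace class operator of trace $1$. For a separable complex Hilbert space $\mathcal{H}$ (here $\mathcal{H}=\mathbb{C}^{d}$) and $k=1,2,3$, $\mathrm{tr}_{\mathcal{H}}^{(k)}[\cdot]$ denotes the partial trace over the $k$-th tensor factor of $\mathcal{H}\otimes\mathcal{H}\otimes\mathcal{H}$; the result is regarded as an operator on $\mathcal{H}\otimes\mathcal{H}$, the two remaining factors being kept in their order. A density source-operator (DSO) for a state $\rho$ on $\mathcal{H}\otimes\mathcal{H}$ is a positive trace class operator $R$ on $\mathcal{H}\otimes\mathcal{H}\otimes\mathcal{H}$ satisfying $\mathrm{tr}_{\mathcal{H}}^{(2)}[R]=\mathrm{tr}_{\mathcal{H}}^{(3)}[R]=\rho$ or $\mathrm{tr}_{\mathcal{H}}^{(1)}[R]=\mathrm{tr}_{\mathcal{H}}^{(2)}[R]=\rho$. A state that has a density source-operator is called a DSO state. A DSO state $\rho$ is called a Bell class DSO state (DSO state of the Bell class) if it has a density source-operator $R$ with $$\mathrm{tr}_{\mathcal{H}}^{(1)}[R]=\mathrm{tr}_{\mathcal{H}}^{(2)}[R]=\mathrm{tr}_{\mathcal{H}}^{(3)}[R]=\rho .$$ It is a known fact that, for any $d\geq 2$, the Werner state $\rho^{(d,\Phi)}$ is separable if $\Phi\in[0,1]$ and nonseparable if $\Phi\in[-1,0)$. *)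

theory Defs
  imports "HOL-Analysis.Analysis"
begin

text \<open>
  The space \<open>\<complex>\<^sup>d\<close> is \<open>complex ^ 'd\<close> with \<open>d = CARD('d)\<close>, and its tensor powers are
  \<open>complex ^ ('d \<times> 'd)\<close> and \<open>complex ^ ('d \<times> 'd \<times> 'd)\<close>, the index \<open>(i, j)\<close> standing for the
  basis vector \<open>e\<^sub>i \<otimes> e\<^sub>j\<close> (see \<open>tensor_vec\<close>). Operators are given by their matrices in these
  product bases; in finite dimension every operator is trace class.
\<close>

definition cinner :: "complex ^ 'n \<Rightarrow> complex ^ 'n \<Rightarrow> complex" where
  "cinner \<phi> \<psi> = (\<Sum>i\<in>UNIV. cnj (\<phi> $ i) * \<psi> $ i)"

text \<open>Over the complex numbers this condition already forces \<open>A\<close> to be self-adjoint.\<close>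

definition positive_operator :: "complex ^ 'n ^ 'n \<Rightarrow> bool" where
  "positive_operator A \<longleftrightarrow> (\<forall>\<psi>. cinner \<psi> (A *v \<psi>) \<in> \<real>\<^sub>\<ge>\<^sub>0)"

definition density_operator :: "complex ^ 'n ^ 'n \<Rightarrow> bool" where
  "density_operator \<rho> \<longleftrightarrow> positive_operator \<rho> \<and> trace \<rho> = 1"

definition tensor_vec :: "complex ^ 'm::finite \<Rightarrow> complex ^ 'n::finite \<Rightarrow> complex ^ ('m \<times> 'n)" where
  "tensor_vec \<phi> \<psi> = (\<chi> p. \<phi> $ fst p * \<psi> $ snd p)"

definition flip_operator :: "complex ^ ('d::finite \<times> 'd) ^ ('d \<times> 'd)" where
  "flip_operator = (\<chi> p q. if q = (snd p, fst p) then 1 else 0)"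

lemma flip_operator_tensor:
  "flip_operator *v tensor_vec \<phi> \<psi> = tensor_vec \<psi> \<phi>"
  by (simp add: vec_eq_iff flip_operator_def tensor_vec_def matrix_vector_mult_def
      if_distrib if_distribR sum.delta' cong: if_cong)

text \<open>The action on product vectors determines the operator.\<close>

lemma flip_operator_unique:
  fixes A :: "complex ^ ('d::finite \<times> 'd) ^ ('d \<times> 'd)"
  assumes "\<And>\<phi> \<psi>. A *v tensor_vec \<phi> \<psi> = tensor_vec \<psi> \<phi>"
  shows "A = flip_operator"
proof -
  have ax: "tensor_vec (axis i 1) (axis j 1) = axis (i, j) (1::complex)" for i j :: 'd
    by (auto simp: vec_eq_iff tensor_vec_def axis_def)
  have col: "M *v axis q 1 = column q M" for M :: "complex ^ ('d \<times> 'd) ^ ('d \<times> 'd)" and q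
    by (simp add: vec_eq_iff column_def matrix_vector_mult_def axis_def if_distrib cong: if_cong)
  have "column q A = column q flip_operator" for q
    using assms[of "axis (fst q) 1" "axis (snd q) 1"]
      flip_operator_tensor[of "axis (fst q) 1" "axis (snd q) 1"]
    by (simp only: ax prod.collapse col)
  then show ?thesis
    by (simp add: vec_eq_iff column_def)
qed

definition ptrace1 :: "complex ^ ('d::finite \<times> 'd \<times> 'd) ^ ('d \<times> 'd \<times> 'd) \<Rightarrow> complex ^ ('d \<times> 'd) ^ ('d \<times> 'd)" where
  "ptrace1 R = (\<chi> p q. \<Sum>m\<in>UNIV. R $ (m, fst p, snd p) $ (m, fst q, snd q))"

definition ptrace2 :: "complex ^ ('d::finite \<times> 'd \<times> 'd) ^ ('d \<times> 'd \<times> 'd) \<Rightarrow> complex ^ ('d \<times> 'd) ^ ('d \<times> 'd)" where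
  "ptrace2 R = (\<chi> p q. \<Sum>m\<in>UNIV. R $ (fst p, m, snd p) $ (fst q, m, snd q))"

definition ptrace3 :: "complex ^ ('d::finite \<times> 'd \<times> 'd) ^ ('d \<times> 'd \<times> 'd) \<Rightarrow> complex ^ ('d \<times> 'd) ^ ('d \<times> 'd)" where
  "ptrace3 R = (\<chi> p q. \<Sum>m\<in>UNIV. R $ (fst p, snd p, m) $ (fst q, snd q, m))"

definition density_source_operator ::
  "complex ^ ('d::finite \<times> 'd \<times> 'd) ^ ('d \<times> 'd \<times> 'd) \<Rightarrow> complex ^ ('d \<times> 'd) ^ ('d \<times> 'd) \<Rightarrow> bool" where
  "density_source_operator R \<rho> \<longleftrightarrow> positive_operator R \<and>
     ((ptrace2 R = \<rho> \<and> ptrace3 R = \<rho>) \<or> (ptrace1 R = \<rho> \<and> ptrace2 R = \<rho>))"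

definition DSO_state :: "complex ^ ('d::finite \<times> 'd) ^ ('d \<times> 'd) \<Rightarrow> bool" where
  "DSO_state \<rho> \<longleftrightarrow> density_operator \<rho> \<and> (\<exists>R. density_source_operator R \<rho>)"

definition Bell_class_DSO_state :: "complex ^ ('d::finite \<times> 'd) ^ ('d \<times> 'd) \<Rightarrow> bool" where
  "Bell_class_DSO_state \<rho> \<longleftrightarrow> DSO_state \<rho> \<and>
     (\<exists>R. density_source_operator R \<rho> \<and> ptrace1 R = \<rho> \<and> ptrace2 R = \<rho> \<and> ptrace3 R = \<rho>)"

text \<open>The dimension \<open>d = CARD('d)\<close> is determined by the type of the result.\<close>

definition werner_state :: "real \<Rightarrow> complex ^ ('d::finite \<times> 'd) ^ ('d \<times> 'd)" where
  "werner_state \<Phi> = (let d = real CARD('d) in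
     ((d - \<Phi>) / (d ^ 3 - d)) *\<^sub>R mat 1 + ((d * \<Phi> - 1) / (d ^ 3 - d)) *\<^sub>R flip_operator)"

end

theory Submission imports Defs
begin

text \<open>
  The source-operators are looked for among the central elements \<open>a I + b T + c K\<close> of the group
  algebra of \<open>S\<^sub>3\<close> permuting the three tensor factors, where \<open>T\<close> is the sum of the transpositions
  and \<open>K\<close> the sum of the two 3-cycles. By symmetry all three partial traces agree, and they are
  \<open>(a d + 2 b) I + (b d + 2 c) V\<close>. Since \<open>I + T + K\<close>, \<open>I - T + K\<close> and \<open>2 I - K\<close> are positive
  multiples of projections (symmetric, antisymmetric and mixed symmetry), nonnegative combinations
  of them are positive. The first two are source-operators, up to normalisation, for \<open>\<Phi> = 1\<close> and
  \<open>\<Phi> = -1\<close> when \<open>d \<ge> 3\<close>. For \<open>d = 2\<close> the antisymmetric one vanishes, and the mixed one gives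
  \<open>\<Phi> = 0\<close> instead. Convex combinations of the extreme cases do the rest.
\<close>

section \<open>Positive operators\<close>

lemma cinner_add_right: "cinner \<phi> (\<psi> + \<eta>) = cinner \<phi> \<psi> + cinner \<phi> \<eta>"
  by (simp add: cinner_def distrib_left sum.distrib)

lemma cinner_scaleR_right: "cinner \<phi> (r *\<^sub>R \<psi>) = r *\<^sub>R cinner \<phi> \<psi>"
  by (simp add: cinner_def scaleR_sum_right)

lemma cinner_self_nonneg: "cinner \<phi> \<phi> \<in> \<real>\<^sub>\<ge>\<^sub>0"
proof -
  have "cinner \<phi> \<phi> = of_real (\<Sum>i\<in>UNIV. (cmod (\<phi> $ i))\<^sup>2)"
    by (simp add: cinner_def mult.commute complex_norm_square del: of_real_power)
  then show ?thesis
    by (simp add: sum_nonneg del: of_real_sum of_real_power)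
qed

lemma positive_operator_add:
  "positive_operator A \<Longrightarrow> positive_operator B \<Longrightarrow> positive_operator (A + B)"
  by (simp add: positive_operator_def matrix_vector_mult_add_rdistrib cinner_add_right
      nonneg_Reals_add_I)

lemma scaleR_matrix_vector_mult: "(r *\<^sub>R A) *v \<psi> = r *\<^sub>R (A *v \<psi>)"
  for A :: "complex ^ 'n ^ 'm"
  by (simp add: matrix_vector_mult_def vec_eq_iff scaleR_sum_right)

lemma positive_operator_scaleR:
  "positive_operator A \<Longrightarrow> 0 \<le> r \<Longrightarrow> positive_operator (r *\<^sub>R A)"
  unfolding positive_operator_def scaleR_matrix_vector_mult cinner_scaleR_right
  by (simp add: scaleR_conv_of_real nonneg_Reals_mult_I)

lemma cinner_hermitian:
  assumes "\<And>p q. A $ p $ q = cnj (A $ q $ p)"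
  shows "cinner (A *v \<phi>) \<psi> = cinner \<phi> (A *v \<psi>)"
proof -
  have "cinner (A *v \<phi>) \<psi> = (\<Sum>p\<in>UNIV. \<Sum>q\<in>UNIV. cnj (\<phi> $ q) * (A $ q $ p * \<psi> $ p))"
    by (simp add: cinner_def matrix_vector_mult_def sum_distrib_left sum_distrib_right mult_ac
        flip: assms)
  also have "\<dots> = cinner \<phi> (A *v \<psi>)"
    by (subst sum.swap) (simp add: cinner_def matrix_vector_mult_def sum_distrib_left)
  finally show ?thesis .
qed

text \<open>With \<open>A\<close> self-adjoint and A^2 = k A, the quadratic form at \<psi> equals
  the squared norm of \<open>A *v \<psi>\<close> divided by \<open>k\<close>. No spectral theory is
  needed for positivity.\<close>

lemma positive_operator_projection_multiple:
  assumes herm: "\<And>p q. A $ p $ q = cnj (A $ q $ p)"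
    and idem: "\<And>\<psi>. A *v (A *v \<psi>) = k *\<^sub>R (A *v \<psi>)" and "k > 0"
  shows "positive_operator A"
  unfolding positive_operator_def
proof
  fix \<psi>
  have "cinner (A *v \<psi>) (A *v \<psi>) = k *\<^sub>R cinner \<psi> (A *v \<psi>)"
    by (simp add: cinner_hermitian[OF herm] idem cinner_scaleR_right)
  then have "cinner \<psi> (A *v \<psi>) = of_real (inverse k) * cinner (A *v \<psi>) (A *v \<psi>)"
    using \<open>k > 0\<close> by (simp add: scaleR_conv_of_real)
  also have "\<dots> \<in> \<real>\<^sub>\<ge>\<^sub>0"
    using \<open>k > 0\<close> by (intro nonneg_Reals_mult_I cinner_self_nonneg) simp
  finally show "cinner \<psi> (A *v \<psi>) \<in> \<real>\<^sub>\<ge>\<^sub>0" .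
qed

section \<open>Permutation operators\<close>

text \<open>Coordinates are pulled back along \<open>f\<close> rather than along its inverse. For
  the operators below the choice is immaterial: transpositions are involutions and the two 3-cycles,
  being mutually inverse, always occur together.\<close>

definition perm_operator :: "('n \<Rightarrow> 'n) \<Rightarrow> complex ^ 'n ^ 'n" where
  "perm_operator f = (\<chi> p q. if q = f p then 1 else 0)"

lemma perm_operator_mult_vec: "(perm_operator f *v \<psi>) $ p = \<psi> $ f p"
  by (simp add: perm_operator_def matrix_vector_mult_def if_distrib if_distribR cong: if_cong)

lemma flip_operator_eq_perm: "flip_operator = perm_operator (\<lambda>(i, j). (j, i))"
  by (simp add: flip_operator_def perm_operator_def case_prod_beta)

definition transposition_sum ::
  "complex ^ ('d::finite \<times> 'd \<times> 'd) ^ ('d \<times> 'd \<times> 'd)" where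
  "transposition_sum = perm_operator (\<lambda>(i, j, k). (j, i, k))
     + perm_operator (\<lambda>(i, j, k). (k, j, i)) + perm_operator (\<lambda>(i, j, k). (i, k, j))"

definition cycle_sum :: "complex ^ ('d::finite \<times> 'd \<times> 'd) ^ ('d \<times> 'd \<times> 'd)" where
  "cycle_sum = perm_operator (\<lambda>(i, j, k). (j, k, i)) + perm_operator (\<lambda>(i, j, k). (k, i, j))"

definition central_operator ::
  "real \<Rightarrow> real \<Rightarrow> real \<Rightarrow> complex ^ ('d::finite \<times> 'd \<times> 'd) ^ ('d \<times> 'd \<times> 'd)" where
  "central_operator a b c = a *\<^sub>R mat 1 + b *\<^sub>R transposition_sum + c *\<^sub>R cycle_sum"

lemma central_operator_entry:
  "central_operator a b c $ (i, j, k) $ (i', j', k') =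
     a *\<^sub>R (if i' = i \<and> j' = j \<and> k' = k then 1 else 0)
   + b *\<^sub>R ((if i' = j \<and> j' = i \<and> k' = k then 1 else 0)
       + (if i' = k \<and> j' = j \<and> k' = i then 1 else 0)
       + (if i' = i \<and> j' = k \<and> k' = j then 1 else 0))
   + c *\<^sub>R ((if i' = j \<and> j' = k \<and> k' = i then 1 else 0)
       + (if i' = k \<and> j' = i \<and> k' = j then 1 else 0))"
  by (auto simp: central_operator_def transposition_sum_def cycle_sum_def perm_operator_def mat_def)

lemma central_operator_mult_vec:
  "(central_operator a b c *v \<psi>) $ (i, j, k) =
     a *\<^sub>R \<psi> $ (i, j, k)
   + b *\<^sub>R (\<psi> $ (j, i, k) + \<psi> $ (k, j, i) + \<psi> $ (i, k, j))
   + c *\<^sub>R (\<psi> $ (j, k, i) + \<psi> $ (k, i, j))"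
  by (simp add: central_operator_def transposition_sum_def cycle_sum_def
      matrix_vector_mult_add_rdistrib scaleR_matrix_vector_mult perm_operator_mult_vec)

text \<open>Taking adjoints inverts permutations: each transposition is fixed, the two 3-cycles are
  exchanged, and the coefficients are real.\<close>

lemma central_operator_hermitian:
  "central_operator a b c $ p $ q = cnj (central_operator a b c $ q $ p)"
proof -
  obtain i j k i' j' k' where "p = (i, j, k)" "q = (i', j', k')"
    by (metis surj_pair)
  then show ?thesis
    by (simp add: central_operator_entry if_distrib[of cnj] eq_commute conj_ac add_ac
        cong: if_cong split del: if_split)
qed

text \<open>The sum over a group of order 6 squares to 6 times itself; the same holds for the sum
  weighted by signs in the next lemma.\<close>

lemma positive_symmetrizer: "positive_operator (central_operator 1 1 1)"
  by (rule positive_operator_projection_multiple[where k = 6, OF central_operator_hermitian])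
    (simp_all only: vec_eq_iff split_paired_All central_operator_mult_vec vector_scaleR_component,
     simp_all add: scaleR_conv_of_real algebra_simps)

lemma positive_antisymmetrizer: "positive_operator (central_operator 1 (-1) 1)"
  by (rule positive_operator_projection_multiple[where k = 6, OF central_operator_hermitian])
    (simp_all only: vec_eq_iff split_paired_All central_operator_mult_vec vector_scaleR_component,
     simp_all add: scaleR_conv_of_real algebra_simps)

text \<open>From K^2 = 2 I + K one gets (2 I - K)^2 = 6 I - 3 K = 3 (2 I - K).\<close>

lemma positive_mixed_symmetrizer: "positive_operator (central_operator 2 0 (-1))"
  by (rule positive_operator_projection_multiple[where k = 3, OF central_operator_hermitian])
    (simp_all only: vec_eq_iff split_paired_All central_operator_mult_vec vector_scaleR_component,
     simp_all add: scaleR_conv_of_real algebra_simps)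

text \<open>Here \<open>x\<close>, \<open>y\<close>, \<open>z\<close> weight the symmetric,
  antisymmetric and mixed operators.\<close>

lemma positive_central_operator:
  assumes "0 \<le> x" "0 \<le> y" "0 \<le> z"
  shows "positive_operator (central_operator (x + y + 2 * z) (x - y) (x + y - z) ::
    complex ^ ('d::finite \<times> 'd \<times> 'd) ^ ('d \<times> 'd \<times> 'd))" (is "positive_operator ?R")
proof -
  have "?R =
      x *\<^sub>R central_operator 1 1 1 + y *\<^sub>R central_operator 1 (-1) 1 + z *\<^sub>R central_operator 2 0 (-1)"
    by (simp add: central_operator_def algebra_simps)
  also have "positive_operator \<dots>"
    using assms by (intro positive_operator_add positive_operator_scaleR positive_symmetrizer
        positive_antisymmetrizer positive_mixed_symmetrizer)
  finally show ?thesis .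
qed

section \<open>Partial traces of permutation operators\<close>

text \<open>These are the shapes taken by the entries of a permutation operator when the traced
  index \<open>m\<close> is pinned by one of the equations.\<close>

lemma sum_if_pivot:
  fixes x :: "'d::finite"
  shows "(\<Sum>m\<in>UNIV. if m = x \<and> P m then 1 else 0) = (if P x then 1 else (0::complex))"
    and "(\<Sum>m\<in>UNIV. if x = m \<and> P m then 1 else 0) = (if P x then 1 else (0::complex))"
    and "(\<Sum>m\<in>UNIV. if Q \<and> m = x \<and> P m then 1 else 0) = (if Q \<and> P x then 1 else (0::complex))"
    and "(\<Sum>m\<in>UNIV. if Q \<and> x = m \<and> P m then 1 else 0) = (if Q \<and> P x then 1 else (0::complex))"
proof -
  have pivot: "(\<Sum>m\<in>UNIV. if m = x \<and> R m then 1 else 0) = (if R x then 1 else (0::complex))" for R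
  proof -
    have "(\<Sum>m\<in>UNIV. if m = x \<and> R m then 1 else 0) =
        (\<Sum>m\<in>UNIV. if m = x then if R m then 1 else 0 else (0::complex))"
      by (rule sum.cong) auto
    then show ?thesis
      by simp
  qed
  from pivot[of P] pivot[of "\<lambda>m. Q \<and> P m"]
  show "(\<Sum>m\<in>UNIV. if m = x \<and> P m then 1 else 0) = (if P x then 1 else (0::complex))"
    and "(\<Sum>m\<in>UNIV. if x = m \<and> P m then 1 else 0) = (if P x then 1 else (0::complex))"
    and "(\<Sum>m\<in>UNIV. if Q \<and> m = x \<and> P m then 1 else 0) = (if Q \<and> P x then 1 else (0::complex))"
    and "(\<Sum>m\<in>UNIV. if Q \<and> x = m \<and> P m then 1 else 0) = (if Q \<and> P x then 1 else (0::complex))"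
    by (simp_all only: eq_commute[of x] conj_left_commute[of Q])
qed

text \<open>Tracing out one factor turns I into d I, the transposition of the other two factors into
  d V, each of the two transpositions moving the traced factor into I, and each 3-cycle into
  V.\<close>

lemma ptrace_central_operator:
  defines "\<rho> a b c \<equiv> (a * CARD('d) + 2 * b) *\<^sub>R mat 1 + (b * CARD('d) + 2 * c) *\<^sub>R flip_operator"
  fixes a b c :: real
  shows "ptrace1 (central_operator a b c :: complex ^ ('d::finite \<times> 'd \<times> 'd) ^ ('d \<times> 'd \<times> 'd)) = \<rho> a b c"
    and "ptrace2 (central_operator a b c :: complex ^ ('d \<times> 'd \<times> 'd) ^ ('d \<times> 'd \<times> 'd)) = \<rho> a b c"
    and "ptrace3 (central_operator a b c :: complex ^ ('d \<times> 'd \<times> 'd) ^ ('d \<times> 'd \<times> 'd)) = \<rho> a b c"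
proof -
  have mat_entry: "mat 1 $ p $ q = (if q = p then 1 else (0::complex))" for p q :: "'d \<times> 'd"
    by (simp add: mat_def)
  note simps = \<rho>_def vec_eq_iff ptrace1_def ptrace2_def ptrace3_def central_operator_entry
    sum.distrib sum_if_pivot mat_entry flip_operator_def
  show "ptrace1 (central_operator a b c) = \<rho> a b c" "ptrace2 (central_operator a b c) = \<rho> a b c"
    "ptrace3 (central_operator a b c) = \<rho> a b c"
    \<comment> \<open>Real coefficients are pulled out of the sums over \<open>m\<close>, so that
      \<open>sum_if_pivot\<close> matches what remains.\<close>
    by (simp_all add: simps split del: if_split flip: scaleR_sum_right)
      (simp_all add: scaleR_conv_of_real algebra_simps conj_commute split del: if_split)
qed

section \<open>Werner states\<close>

text \<open>The hypotheses bound the eigenvalues \<alpha> + \<beta> and \<alpha> - \<beta> on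
  symmetric and antisymmetric vectors; I + V and I - V are twice the corresponding
  projections.\<close>

lemma positive_flip_combination:
  assumes "0 \<le> \<alpha> + \<beta>" "0 \<le> \<alpha> - \<beta>"
  shows "positive_operator
    (\<alpha> *\<^sub>R mat 1 + \<beta> *\<^sub>R (flip_operator :: complex ^ ('d::finite \<times> 'd) ^ ('d \<times> 'd)))"
proof -
  have mult: "((mat 1 + s *\<^sub>R flip_operator) *v \<psi>) $ (i, j) = \<psi> $ (i, j) + s *\<^sub>R \<psi> $ (j, i)"
    for s :: real and \<psi> and i j :: 'd
    by (simp add: matrix_vector_mult_add_rdistrib scaleR_matrix_vector_mult
        flip_operator_eq_perm perm_operator_mult_vec)
  have pos: "positive_operator (mat 1 + s *\<^sub>R (flip_operator :: complex ^ ('d \<times> 'd) ^ ('d \<times> 'd)))"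
    if "s = 1 \<or> s = -1" for s :: real
  proof (rule positive_operator_projection_multiple[where k = 2])
    fix \<psi> :: "complex ^ ('d \<times> 'd)"
    show "(mat 1 + s *\<^sub>R flip_operator) *v ((mat 1 + s *\<^sub>R flip_operator) *v \<psi>) =
        2 *\<^sub>R ((mat 1 + s *\<^sub>R flip_operator) *v \<psi>)"
      using that by (simp only: vec_eq_iff split_paired_All mult vector_scaleR_component)
        (auto simp: scaleR_conv_of_real)
  qed (auto simp: flip_operator_def mat_def)
  have "\<alpha> *\<^sub>R mat 1 + \<beta> *\<^sub>R flip_operator =
      ((\<alpha> + \<beta>) / 2) *\<^sub>R (mat 1 + 1 *\<^sub>R (flip_operator :: complex ^ ('d \<times> 'd) ^ ('d \<times> 'd)))
    + ((\<alpha> - \<beta>) / 2) *\<^sub>R (mat 1 + (-1) *\<^sub>R flip_operator)"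
    by (simp only: vec_eq_iff vector_add_component vector_scaleR_component)
      (simp add: scaleR_conv_of_real field_simps)
  with assms show ?thesis
    by (simp only:) (intro positive_operator_add positive_operator_scaleR pos; simp)
qed

lemma trace_flip_operator: "trace (flip_operator :: complex ^ ('d::finite \<times> 'd) ^ ('d \<times> 'd)) = CARD('d)"
proof -
  have "trace (flip_operator :: complex ^ ('d \<times> 'd) ^ ('d \<times> 'd)) =
      (\<Sum>(i, j)\<in>UNIV \<times> UNIV. if (i::'d) = j then 1 else 0)"
    by (auto simp: trace_def flip_operator_def intro!: sum.cong)
  also have "\<dots> = of_nat CARD('d)"
    by (simp flip: sum.cartesian_product del: UNIV_Times_UNIV)
  finally show ?thesis .
qed

lemma density_operator_werner_state:
  assumes "CARD('d::finite) \<ge> 2" "\<Phi> \<in> {-1..1}"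
  shows "density_operator (werner_state \<Phi> :: complex ^ ('d \<times> 'd) ^ ('d \<times> 'd))"
proof -
  define d where "d = real CARD('d)"
  define \<alpha> where "\<alpha> = (d - \<Phi>) / (d ^ 3 - d)"
  define \<beta> where "\<beta> = (d * \<Phi> - 1) / (d ^ 3 - d)"
  have d: "d \<ge> 2" using assms by (simp add: d_def)
  have fac: "d ^ 3 - d = d * (d - 1) * (d + 1)"
    by (simp add: algebra_simps power3_eq_cube)
  have pos: "d * (d - 1) * (d + 1) > 0" using d by simp
  have W: "werner_state \<Phi> =
      \<alpha> *\<^sub>R mat 1 + \<beta> *\<^sub>R (flip_operator :: complex ^ ('d \<times> 'd) ^ ('d \<times> 'd))"
    by (simp add: werner_state_def Let_def \<alpha>_def \<beta>_def d_def)
  have "\<alpha> + \<beta> = (d - 1) * (1 + \<Phi>) / (d ^ 3 - d)" "\<alpha> - \<beta> = (d + 1) * (1 - \<Phi>) / (d ^ 3 - d)"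
    by (simp_all add: \<alpha>_def \<beta>_def algebra_simps flip: add_divide_distrib diff_divide_distrib)
  then have "0 \<le> \<alpha> + \<beta>" "0 \<le> \<alpha> - \<beta>"
    using d assms pos by (simp_all add: fac)
  then have "positive_operator (werner_state \<Phi> :: complex ^ ('d \<times> 'd) ^ ('d \<times> 'd))"
    unfolding W by (rule positive_flip_combination)
  moreover have "trace (werner_state \<Phi> :: complex ^ ('d \<times> 'd) ^ ('d \<times> 'd)) = of_real (\<alpha> * d\<^sup>2 + \<beta> * d)"
  proof -
    have "trace (r *\<^sub>R A) = r *\<^sub>R trace A" for r and A :: "complex ^ ('d \<times> 'd) ^ ('d \<times> 'd)"
      by (simp add: trace_def scaleR_sum_right)
    then show ?thesis
      by (simp add: W trace_add trace_I trace_flip_operator d_def scaleR_conv_of_real power2_eq_square)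
  qed
  moreover have "\<alpha> * d\<^sup>2 + \<beta> * d = 1"
  proof -
    have "\<alpha> * d\<^sup>2 + \<beta> * d = (d ^ 3 - d) / (d ^ 3 - d)"
      by (simp add: \<alpha>_def \<beta>_def algebra_simps power2_eq_square power3_eq_cube
          flip: add_divide_distrib diff_divide_distrib)
    moreover have "d ^ 3 - d \<noteq> 0"
      using pos by (metis fac less_irrefl)
    ultimately show ?thesis
      by simp
  qed
  ultimately show ?thesis
    by (simp add: density_operator_def)
qed

text \<open>\<open>I\<close> and \<open>V\<close> equate the coefficients of identity and flip in
  the common partial trace with those of the Werner state. What remains is a linear system to be
  solved in nonnegative weights.\<close>

lemma Bell_class_werner_stateI:
  fixes \<Phi> x y z :: real
  defines "d \<equiv> real CARD('d::finite)"
  assumes "CARD('d) \<ge> 2" "\<Phi> \<in> {-1..1}" "0 \<le> x" "0 \<le> y" "0 \<le> z"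
    and I: "(x + y + 2 * z) * d + 2 * (x - y) = (d - \<Phi>) / (d ^ 3 - d)"
    and V: "(x - y) * d + 2 * (x + y - z) = (d * \<Phi> - 1) / (d ^ 3 - d)"
  shows "Bell_class_DSO_state (werner_state \<Phi> :: complex ^ ('d \<times> 'd) ^ ('d \<times> 'd))"
proof -
  let ?R = "central_operator (x + y + 2 * z) (x - y) (x + y - z) ::
    complex ^ ('d \<times> 'd \<times> 'd) ^ ('d \<times> 'd \<times> 'd)"
  have "ptrace1 ?R = werner_state \<Phi>" "ptrace2 ?R = werner_state \<Phi>" "ptrace3 ?R = werner_state \<Phi>"
    using I V unfolding ptrace_central_operator by (simp_all add: werner_state_def Let_def d_def)
  moreover have "positive_operator ?R"
    using assms by (intro positive_central_operator)
  ultimately show ?thesis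
    using density_operator_werner_state[OF assms(2,3)]
    unfolding Bell_class_DSO_state_def DSO_state_def density_source_operator_def by blast
qed

theorem theorem3:
  "(CARD('d::finite) \<ge> 3 \<longrightarrow>
      (\<forall>\<Phi>::real. \<Phi> \<in> {-1..1} \<longrightarrow>
        Bell_class_DSO_state (werner_state \<Phi> :: complex ^ ('d \<times> 'd) ^ ('d \<times> 'd)))) \<and>
   (CARD('d) = 2 \<longrightarrow>
      (\<forall>\<Phi>::real. \<Phi> \<in> {0..1} \<longrightarrow>
        Bell_class_DSO_state (werner_state \<Phi> :: complex ^ ('d \<times> 'd) ^ ('d \<times> 'd))))"
proof (intro conjI impI allI)
  fix \<Phi> :: real
  assume card: "CARD('d) \<ge> 3" and \<Phi>: "\<Phi> \<in> {-1..1}"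
  define d where "d = real CARD('d)"
  \<comment> \<open>With z = 0 the system prescribes the sum and the difference of x (d + 2) and y
    (d - 2); half their sum and half their difference give these weights. Solving for
    \<open>y\<close> divides by d - 2, which is positive as d \<ge> 3.\<close>
  define x where "x = (1 + \<Phi>) / (2 * (d * (d + 1) * (d + 2)))"
  define y where "y = (1 - \<Phi>) / (2 * (d * (d - 1) * (d - 2)))"
  have d: "d \<ge> 3" using card by (simp add: d_def)
  have fac: "d ^ 3 - d = d * (d - 1) * (d + 1)"
    by (simp add: algebra_simps power3_eq_cube)
  have x: "x * (d + 2) = (1 + \<Phi>) / (2 * (d * (d + 1)))"
    using d by (simp add: x_def)
  have y: "y * (d - 2) = (1 - \<Phi>) / (2 * (d * (d - 1)))"
    using d by (simp add: y_def)
  have "(x + y + 2 * 0) * d + 2 * (x - y) = x * (d + 2) + y * (d - 2)"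
    by (simp add: algebra_simps)
  also have "\<dots> = (d - \<Phi>) / (d ^ 3 - d)"
    using d unfolding x y fac by (simp add: divide_simps) (simp add: algebra_simps)
  finally have I: "(x + y + 2 * 0) * d + 2 * (x - y) = (d - \<Phi>) / (d ^ 3 - d)" .
  have "(x - y) * d + 2 * (x + y - 0) = x * (d + 2) - y * (d - 2)"
    by (simp add: algebra_simps)
  also have "\<dots> = (d * \<Phi> - 1) / (d ^ 3 - d)"
    using d unfolding x y fac by (simp add: divide_simps) (simp add: algebra_simps)
  finally have V: "(x - y) * d + 2 * (x + y - 0) = (d * \<Phi> - 1) / (d ^ 3 - d)" .
  have "0 \<le> x" "0 \<le> y"
    using d \<Phi> by (simp_all add: x_def y_def)
  then show "Bell_class_DSO_state (werner_state \<Phi> :: complex ^ ('d \<times> 'd) ^ ('d \<times> 'd))"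
    using card \<Phi> I V unfolding d_def by (intro Bell_class_werner_stateI[of \<Phi> x y 0]) auto
next
  fix \<Phi> :: real
  assume "CARD('d) = 2" and "\<Phi> \<in> {0..1}"
  then show "Bell_class_DSO_state (werner_state \<Phi> :: complex ^ ('d \<times> 'd) ^ ('d \<times> 'd))"
    \<comment> \<open>For d = 2 the weight \<open>y\<close> drops out of both equations, leaving 4 x
      + 4 z = (2 - \<Phi>) / 6 and 4 x - 2 z = (2 \<Phi> - 1) / 6. The solution has x \<ge> 0
      exactly when \<Phi> \<ge> 0.\<close>
    by (intro Bell_class_werner_stateI[of \<Phi> "\<Phi> / 24" 0 "(1 - \<Phi>) / 12"]) (auto simp: field_simps)
qed

end
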